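(* Let $m \geq 3$ be an integer with $m \neq 6$. Then all extremal solutions $x$ of the congruence $(\mathrm{C}_m)$ have width $\sigma(x) = 1$ or $\sigma(x) = 2$. There are exactly $2\varphi(m)$ extremal solutions of $(\mathrm{C}_m)$, where $\varphi$ is the Euler totient function.
   Context: $\mathbb{N} = \{0,1,2,\ldots\}$. For an integer $m \geq 2$, $(\mathrm{C}_m)$ denotes the congruence $1\cdot x_1 + 2\cdot x_2 + \cdots + (m-1)\cdot x_{m-1} \equiv 0 \pmod m$ for unknown $x = (x_1,\ldots,x_{m-1}) \in \mathbb{N}^{m-1}$. A solution is indecomposable if it is nonzero and minimal among the nonzero solutions in $\mathbb{N}^{m-1}$ with respect to the componentwise order. For $x \in \mathbb{N}^{m-1}$: the length is $\|x\|_1 = x_1 + \cdots + x_{m-1}$; the support is $\operatorname{supp}(x) = \{i : x_i \neq 0\}$; the width is $\sigma(x) = \#\operatorname{supp}(x)$. Every indecomposable solution satisfies the Eggleton-Erdős bound $\|x\|_1 + \sigma(x) \leq m+1$; a solution is called extremal if it is indecomposable and $\|x\|_1 + \sigma(x) = m+1$.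
   Formalization: The count of exactly 2φ(m) extremal solutions is stated only for m ≠ 3, because for m = 3 there are three extremal solutions, (3,0), (0,3) and (1,1), whereas 2φ(3) = 4; the width claim still covers m = 3. *)

theory Defs
  imports "HOL-Number_Theory.Number_Theory"
begin

text \<open>
  A vector \<open>(x\<^sub>1, \<dots>, x\<^sub>m\<^sub>-\<^sub>1)\<close> of natural numbers is represented by the function
  \<open>x :: nat \<Rightarrow> nat\<close> that extends it by zero outside \<open>{1..<m}\<close>.  This makes the representation
  unique, so solutions can be counted with \<open>card\<close>, and the componentwise order is the
  pointwise order \<open>\<le>\<close> on functions.
\<close>

definition vectors :: "nat \<Rightarrow> (nat \<Rightarrow> nat) set" where
  "vectors m = {x. \<forall>i. i \<notin> {1..<m} \<longrightarrow> x i = 0}"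

definition solutions :: "nat \<Rightarrow> (nat \<Rightarrow> nat) set" where
  "solutions m = {x \<in> vectors m. [(\<Sum>i = 1..<m. i * x i) = 0] (mod m)}"

definition nonzero_solutions :: "nat \<Rightarrow> (nat \<Rightarrow> nat) set" where
  "nonzero_solutions m = solutions m - {\<lambda>_. 0}"

definition indecomposable :: "nat \<Rightarrow> (nat \<Rightarrow> nat) \<Rightarrow> bool" where
  "indecomposable m x \<longleftrightarrow>
     x \<in> nonzero_solutions m \<and> (\<forall>y \<in> nonzero_solutions m. y \<le> x \<longrightarrow> y = x)"

definition vlength :: "nat \<Rightarrow> (nat \<Rightarrow> nat) \<Rightarrow> nat" where
  "vlength m x = (\<Sum>i = 1..<m. x i)"

definition supp :: "nat \<Rightarrow> (nat \<Rightarrow> nat) \<Rightarrow> nat set" where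
  "supp m x = {i \<in> {1..<m}. x i \<noteq> 0}"

definition width :: "nat \<Rightarrow> (nat \<Rightarrow> nat) \<Rightarrow> nat" where
  "width m x = card (supp m x)"

definition extremal :: "nat \<Rightarrow> (nat \<Rightarrow> nat) \<Rightarrow> bool" where
  "extremal m x \<longleftrightarrow> indecomposable m x \<and> vlength m x + width m x = m + 1"

end

theory Submission
  imports Defs "HOL-Library.Multiset"
begin

text \<open>
  A solution is a multiset \<open>M\<close> of nonzero residues with sum zero, and an indecomposable one is
  a minimal zero-sum multiset, so that its proper submultisets are zero-sum free.  Let \<open>s A\<close> be the
  number of residues that are subsums of \<open>A\<close>, including the empty one.  By Scherk's theorem
  \<open>s (A + B) + 1 \<ge> s A + s B\<close> if \<open>A + B\<close> is zero-sum free.  Taking out one element of \<open>M\<close>, this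
  yields \<open>s A + size M \<le> m + 1 + size A\<close> for every proper submultiset \<open>A\<close>.  For extremal \<open>M\<close> of
  width \<open>w\<close> this reads \<open>s A \<le> size A + w\<close>.  If \<open>w \<ge> 4\<close>, the support \<open>A\<close> of \<open>M\<close> violates this, as
  \<open>s A \<ge> 2 w + 1\<close>.  If \<open>w = 3\<close>, the same holds unless the support is \<open>{h, b, b + h}\<close> with
  \<open>2 h = m\<close>, and then \<open>{h, b, b + h, b, b + h}\<close> is a violation unless \<open>m = 6\<close>.  If \<open>w = 2\<close>, then
  \<open>{a, b, a, b}\<close> is a violation, so one element occurs only once and \<open>M\<close> consists of \<open>2 a\<close> and
  \<open>m - 2\<close> copies of a generator \<open>a\<close>.  If \<open>w = 1\<close>, then \<open>M\<close> consists of \<open>m\<close> copies of a generator.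
\<close>

subsection \<open>Scherk's theorem modulo m\<close>

lemma finite_image_mod:
  fixes f :: "'a \<Rightarrow> nat"
  assumes "m > 0"
  shows "finite ((\<lambda>x. f x mod m) ` A)"
  by (rule finite_subset[of _ "{..<m}"]) (use assms in auto)

text \<open>Induction on the number of residues in \<open>Y\<close> by an e-transform: part of a
  translate of \<open>Y\<close> is moved into \<open>X\<close> so that the two cardinalities keep
  their sum, the sumset does not grow, and zero still has only the trivial representation. When
  \<open>Y\<close> has shrunk to the zero residue, the sumset contains \<open>X\<close> and the
  bound is immediate.\<close>

lemma scherk_mod:
  fixes X Y :: "nat set"
  assumes "m > 0" "0 \<in> X" "0 \<in> Y"
    and "\<And>x y. x \<in> X \<Longrightarrow> y \<in> Y \<Longrightarrow> m dvd x + y \<Longrightarrow> m dvd x"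
  shows "card ((\<lambda>x. x mod m) ` X) + card ((\<lambda>x. x mod m) ` Y)
    \<le> card ((\<lambda>(x, y). (x + y) mod m) ` (X \<times> Y)) + 1"
  using assms(2-)
proof (induction "card ((\<lambda>x. x mod m) ` Y)" arbitrary: X Y rule: less_induct)
  case less
  define r where "r = (\<lambda>x. x mod m)"
  have fin: "finite (r ` Z)" for Z
    unfolding r_def using \<open>m > 0\<close> by (rule finite_image_mod)
  have r_iff: "r x = r y \<longleftrightarrow> [x = y] (mod m)" for x y
    by (simp add: r_def cong_def)
  have fin2: "finite ((\<lambda>(x, y). (x + y) mod m) ` (X \<times> Y))"
    unfolding case_prod_unfold using \<open>m > 0\<close> by (rule finite_image_mod)
  have XY: "m dvd x" "m dvd y" if "x \<in> X" "y \<in> Y" "m dvd x + y" for x y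
    using less.prems(3)[OF that] that(3) by (auto simp: dvd_add_right_iff)
  show ?case
  proof (cases "\<forall>y\<in>Y. m dvd y")
    case True
    hence "r ` Y \<subseteq> {0}" by (auto simp: r_def)
    hence "card (r ` Y) \<le> card {0::nat}" by (rule card_mono[rotated]) simp
    moreover have "r ` X \<subseteq> (\<lambda>(x, y). (x + y) mod m) ` (X \<times> Y)"
    proof
      fix z assume "z \<in> r ` X"
      then obtain x where "x \<in> X" "z = r x" by auto
      thus "z \<in> (\<lambda>(x, y). (x + y) mod m) ` (X \<times> Y)"
        using less.prems(2) by (intro image_eqI[of _ _ "(x, 0)"]) (auto simp: r_def)
    qed
    moreover note fin2
    ultimately show ?thesis
      using card_mono[of "(\<lambda>(x, y). (x + y) mod m) ` (X \<times> Y)" "r ` X"]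
      by (simp add: r_def)
  next
    case False
    then obtain y0 where y0: "y0 \<in> Y" "\<not> m dvd y0" by auto
    \<comment> \<open>Otherwise \<open>X\<close> is closed under adding \<open>y0\<close> and contains \<open>-y0 = (m - 1) y0\<close>.\<close>
    have "\<exists>e\<in>X. \<exists>y\<in>Y. r (e + y) \<notin> r ` X"
    proof (rule ccontr)
      assume "\<not> ?thesis"
      hence closed: "r (e + y0) \<in> r ` X" if "e \<in> X" for e
        using that y0 by blast
      have "r (k * y0) \<in> r ` X" for k
      proof (induction k)
        case 0
        show ?case using less.prems(1) by auto
      next
        case (Suc k)
        then obtain x where x: "x \<in> X" "[k * y0 = x] (mod m)" by (auto simp: r_iff)
        hence "[Suc k * y0 = x + y0] (mod m)"
          using cong_add[OF x(2) cong_refl[of y0]] by (simp add: add.commute)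
        thus ?case using closed[OF x(1)] by (metis r_iff)
      qed
      from this[of "m - 1"] obtain x where x: "x \<in> X" "[(m - 1) * y0 = x] (mod m)"
        by (auto simp: r_iff)
      have "[(m - 1) * y0 + y0 = x + y0] (mod m)"
        using x(2) by (rule cong_add) simp
      moreover have "(m - 1) * y0 + y0 = m * y0"
        using \<open>m > 0\<close> by (cases m) auto
      ultimately have "m dvd x + y0"
        by (metis cong_dvd_iff dvd_triv_left)
      thus False using XY(2)[OF x(1) y0(1)] y0(2) by blast
    qed
    then obtain e y1 where e: "e \<in> X" "y1 \<in> Y" "r (e + y1) \<notin> r ` X" by auto
    \<comment> \<open>The transform at \<open>e\<close>. Since \<open>e\<close> lies in
      \<open>X\<close>, \<open>0\<close> remains in \<open>Y'\<close>; since \<open>e + y1\<close>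
      escapes \<open>X\<close> modulo \<open>m\<close>, the residue of \<open>y1\<close> is lost, so
      the induction applies.\<close>
    define X' where "X' = X \<union> (+) e ` Y"
    define Y' where "Y' = {y \<in> Y. r (e + y) \<in> r ` X}"
    have shift: "r (e + y) = r (e + z) \<longleftrightarrow> r y = r z" for y z
      by (simp add: r_iff cong_add_lcancel_nat)
    have "r ` Y' \<subseteq> r ` Y" by (auto simp: Y'_def)
    moreover have "r y1 \<notin> r ` Y'"
    proof
      assume "r y1 \<in> r ` Y'"
      then obtain y where "y \<in> Y'" "r y1 = r y" by auto
      thus False using e(3) shift[of y1 y] by (auto simp: Y'_def)
    qed
    ultimately have smaller: "card (r ` Y') < card (r ` Y)"
      using e(2) by (intro psubset_card_mono fin) auto
    have step: "card (r ` X') + card (r ` Y') \<le> card ((\<lambda>(x, y). (x + y) mod m) ` (X' \<times> Y')) + 1"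
      unfolding r_def
    proof (rule less.hyps)
      show "card ((\<lambda>x. x mod m) ` Y') < card ((\<lambda>x. x mod m) ` Y)"
        using smaller by (simp add: r_def)
      show "0 \<in> X'" "0 \<in> Y'" using less.prems(1,2) e by (auto simp: X'_def Y'_def)
      fix x y assume *: "x \<in> X'" "y \<in> Y'" "m dvd x + y"
      show "m dvd x"
      proof (cases "x \<in> X")
        case True
        thus ?thesis using * XY[of x y] by (auto simp: Y'_def)
      next
        case False
        then obtain y2 where y2: "y2 \<in> Y" "x = e + y2" using * by (auto simp: X'_def)
        \<comment> \<open>The summands are exchanged: \<open>x + y = (e + y) + y2\<close> is
          congruent to \<open>x2 + y2\<close>, a sum from the original sets. Hence \<open>x2\<close>
          and \<open>y2\<close> vanish modulo \<open>m\<close>, then \<open>e + y\<close> does, then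
          \<open>e\<close>. The same exchange shows below that the sumset does not grow.\<close>
        obtain x2 where x2: "x2 \<in> X" "[e + y = x2] (mod m)"
          using *(2) by (auto simp: Y'_def r_iff)
        have "[e + y + y2 = x2 + y2] (mod m)" using x2(2) by (rule cong_add) simp
        hence "m dvd x2 + y2"
          using *(3) y2(2) by (metis add.assoc add.commute cong_dvd_iff)
        with x2 y2 have "m dvd x2" "m dvd y2" using XY by blast+
        hence "m dvd e + y" using x2(2) cong_dvd_iff by blast
        hence "m dvd e" using XY(1) e(1) *(2) by (auto simp: Y'_def)
        thus ?thesis using \<open>m dvd y2\<close> y2 by simp
      qed
    qed
    have "(\<lambda>(x, y). (x + y) mod m) ` (X' \<times> Y') \<subseteq> (\<lambda>(x, y). (x + y) mod m) ` (X \<times> Y)"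
    proof clarify
      fix x y assume *: "x \<in> X'" "y \<in> Y'"
      show "(x + y) mod m \<in> (\<lambda>(x, y). (x + y) mod m) ` (X \<times> Y)"
      proof (cases "x \<in> X")
        case True
        thus ?thesis using * by (auto simp: Y'_def)
      next
        case False
        then obtain y2 where y2: "y2 \<in> Y" "x = e + y2" using * by (auto simp: X'_def)
        obtain x2 where x2: "x2 \<in> X" "[e + y = x2] (mod m)"
          using *(2) by (auto simp: Y'_def r_iff)
        have "[e + y + y2 = x2 + y2] (mod m)" using x2(2) by (rule cong_add) simp
        hence "(x + y) mod m = (x2 + y2) mod m" using y2 by (simp add: cong_def ac_simps)
        thus ?thesis using x2 y2 by auto
      qed
    qed
    hence le: "card ((\<lambda>(x, y). (x + y) mod m) ` (X' \<times> Y')) \<le> card ((\<lambda>(x, y). (x + y) mod m) ` (X \<times> Y))"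
      by (rule card_mono[OF fin2])
    \<comment> \<open>Inclusion-exclusion for \<open>X\<close> and the translate
      \<open>e + Y\<close> modulo \<open>m\<close>: they meet exactly in \<open>e + Y'\<close>, and
      translation by \<open>e\<close> is injective on residues.\<close>
    moreover have "card (r ` X') + card (r ` Y') = card (r ` X) + card (r ` Y)"
    proof -
      have eq: "r ` X' = r ` X \<union> (\<lambda>y. r (e + y)) ` Y"
        by (auto simp: X'_def)
      have i: "r ` X \<inter> (\<lambda>y. r (e + y)) ` Y = (\<lambda>y. r (e + y)) ` Y'"
      proof (intro equalityI subsetI)
        fix z assume z: "z \<in> r ` X \<inter> (\<lambda>y. r (e + y)) ` Y"
        then obtain y where y: "y \<in> Y" "z = r (e + y)" by auto
        moreover from z have "r (e + y) \<in> r ` X" unfolding y(2) by (rule IntD1)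
        ultimately have "y \<in> Y'" unfolding Y'_def by blast
        thus "z \<in> (\<lambda>y. r (e + y)) ` Y'" using y by blast
      qed (auto simp: Y'_def)
      have rr: "r (r y) = r y" for y by (simp add: r_def)
      have c: "card ((\<lambda>y. r (e + y)) ` Z) = card (r ` Z)" for Z
      proof -
        have "(\<lambda>y. r (e + y)) ` Z = (\<lambda>z. r (e + z)) ` r ` Z"
          by (simp add: image_image r_def mod_add_right_eq)
        moreover have "inj_on (\<lambda>z. r (e + z)) (r ` Z)"
          by (rule inj_onI) (auto simp: shift rr)
        ultimately show ?thesis by (simp add: card_image)
      qed
      have f2: "finite ((\<lambda>y. r (e + y)) ` Y)"
        using fin[of "(+) e ` Y"] by (simp add: image_image)
      show ?thesis
        using card_Un_Int[OF fin[of X] f2] by (simp only: eq i c)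
    qed
    ultimately have "card (r ` X) + card (r ` Y) \<le> card ((\<lambda>(x, y). (x + y) mod m) ` (X \<times> Y)) + 1"
      using order_trans[OF step add_right_mono[OF le]] by (simp only:)
    thus ?thesis unfolding r_def .
  qed
qed

subsection \<open>Subsums of zero-sum free multisets\<close>

definition subsums :: "nat \<Rightarrow> nat multiset \<Rightarrow> nat set" where
  "subsums m M = (\<lambda>N. sum_mset N mod m) ` {N. N \<subseteq># M}"

definition zero_sum_free :: "nat \<Rightarrow> nat multiset \<Rightarrow> bool" where
  "zero_sum_free m M \<longleftrightarrow> (\<forall>N. N \<subseteq># M \<longrightarrow> m dvd sum_mset N \<longrightarrow> N = {#})"

lemma subsums_subset: "m > 0 \<Longrightarrow> subsums m M \<subseteq> {..<m}"
  by (auto simp: subsums_def)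

lemma finite_subsums: "m > 0 \<Longrightarrow> finite (subsums m M)"
  by (rule finite_subset[OF subsums_subset]) auto

lemma card_subsums_le: "m > 0 \<Longrightarrow> card (subsums m M) \<le> m"
  using card_mono[OF _ subsums_subset[of m M]] by simp

lemma in_subsums: "N \<subseteq># M \<Longrightarrow> sum_mset N mod m \<in> subsums m M"
  by (auto simp: subsums_def)

lemma zero_sum_free_mono: "zero_sum_free m M \<Longrightarrow> N \<subseteq># M \<Longrightarrow> zero_sum_free m N"
  by (meson zero_sum_free_def subset_mset.order_trans)

text \<open>Scherk's theorem for the subsums of \<open>A\<close> and of \<open>B\<close>. If a
  subsum of \<open>A\<close> and one of \<open>B\<close> add up to zero, they form a zero subsum of
  \<open>A + B\<close>, so both come from the empty multiset.\<close>

lemma card_subsums_add: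
  assumes "m > 0" "zero_sum_free m (A + B)"
  shows "card (subsums m A) + card (subsums m B) \<le> card (subsums m (A + B)) + 1"
proof -
  define X where "X = sum_mset ` {N. N \<subseteq># A}"
  define Y where "Y = sum_mset ` {N. N \<subseteq># B}"
  have XY: "(\<lambda>x. x mod m) ` X = subsums m A" "(\<lambda>x. x mod m) ` Y = subsums m B"
    unfolding X_def Y_def subsums_def image_image by (rule refl)+
  have "card ((\<lambda>x. x mod m) ` X) + card ((\<lambda>x. x mod m) ` Y)
    \<le> card ((\<lambda>(x, y). (x + y) mod m) ` (X \<times> Y)) + 1"
  proof (rule scherk_mod[OF \<open>m > 0\<close>])
    show "0 \<in> X" unfolding X_def by (rule image_eqI[of _ _ "{#}"]) auto
    show "0 \<in> Y" unfolding Y_def by (rule image_eqI[of _ _ "{#}"]) auto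
    fix x y assume "x \<in> X" "y \<in> Y" and d: "m dvd x + y"
    then obtain N K where *: "N \<subseteq># A" "K \<subseteq># B" "x = sum_mset N" "y = sum_mset K"
      by (auto simp: X_def Y_def)
    hence "N + K \<subseteq># A + B" by (simp add: subset_mset.add_mono)
    hence "N + K = {#}" using assms(2) d * by (auto simp: zero_sum_free_def)
    thus "m dvd x" using * by simp
  qed
  moreover have "(\<lambda>(x, y). (x + y) mod m) ` (X \<times> Y) \<subseteq> subsums m (A + B)"
  proof clarify
    fix x y assume "x \<in> X" "y \<in> Y"
    then obtain N K where *: "N \<subseteq># A" "K \<subseteq># B" "x = sum_mset N" "y = sum_mset K"
      by (auto simp: X_def Y_def)
    hence "N + K \<subseteq># A + B" by (simp add: subset_mset.add_mono)
    from in_subsums[OF this, of m] show "(x + y) mod m \<in> subsums m (A + B)" using * by simp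
  qed
  from card_mono[OF finite_subsums[OF \<open>m > 0\<close>] this]
    have "card ((\<lambda>(x, y). (x + y) mod m) ` (X \<times> Y)) \<le> card (subsums m (A + B))" .
  ultimately have "card ((\<lambda>x. x mod m) ` X) + card ((\<lambda>x. x mod m) ` Y) \<le> card (subsums m (A + B)) + 1"
    by linarith
  thus ?thesis unfolding XY .
qed

lemma mod_eq_iff_int_dvd: "a mod m = b mod m \<longleftrightarrow> int m dvd int a - int b"
proof -
  have "a mod m = b mod m \<longleftrightarrow> [int a = int b] (mod int m)"
    unfolding cong_int_iff by (rule cong_def[symmetric])
  thus ?thesis by (simp only: cong_iff_dvd_diff)
qed

text \<open>The device for all small cases: an explicit list of submultisets with pairwise
  incongruent sums. On a concrete list, \<open>sorted_wrt\<close> unfolds to one condition per pair,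
  and integer differences let common summands cancel.\<close>

lemma card_subsums_ge_length:
  assumes "m > 0" "\<forall>N\<in>set Ns. N \<subseteq># M"
    and "sorted_wrt (\<lambda>N K. \<not> int m dvd int (sum_mset N) - int (sum_mset K)) Ns"
  shows "length Ns \<le> card (subsums m M)"
proof -
  have "distinct (map (\<lambda>N. sum_mset N mod m) Ns)"
    using assms(3) by (induction Ns) (auto simp: mod_eq_iff_int_dvd)
  hence "length Ns = card (set (map (\<lambda>N. sum_mset N mod m) Ns))"
    using distinct_card by fastforce
  also have "\<dots> \<le> card (subsums m M)"
    by (rule card_mono[OF finite_subsums[OF assms(1)]]) (use assms(2) in \<open>auto simp: in_subsums\<close>)
  finally show ?thesis .
qed

lemma zero_sum_free_not_dvd:
  "zero_sum_free m M \<Longrightarrow> N \<subseteq># M \<Longrightarrow> N \<noteq> {#} \<Longrightarrow> \<not> int m dvd int (sum_mset N)"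
  unfolding int_dvd_int_iff by (auto simp: zero_sum_free_def)

text \<open>A single element has the two subsums \<open>0\<close> and \<open>a\<close>, so by
  \<open>card_subsums_add\<close> each further element brings at least one new residue.\<close>

lemma card_subsums_ge_size:
  assumes "m > 0" "zero_sum_free m M"
  shows "card (subsums m M) \<ge> size M + 1"
  using assms(2)
proof (induction M)
  case empty
  show ?case using card_subsums_ge_length[of m "[{#}]" "{#}"] \<open>m > 0\<close> by simp
next
  case (add a M)
  have "card (subsums m {#a#}) \<ge> 2"
    using card_subsums_ge_length[of m "[{#a#}, {#}]" "{#a#}"] \<open>m > 0\<close>
      zero_sum_free_not_dvd[OF add.prems, of "{#a#}"] by simp
  moreover have "zero_sum_free m M" using add.prems by (rule zero_sum_free_mono) simp
  moreover have "card (subsums m {#a#}) + card (subsums m M) \<le> card (subsums m (add_mset a M)) + 1"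
    using card_subsums_add[of m "{#a#}" M] add.prems \<open>m > 0\<close> by simp
  ultimately have "size M + 2 \<le> card (subsums m (add_mset a M))"
    using add.IH by linarith
  thus ?case by simp
qed

text \<open>The complement of \<open>A\<close> in \<open>M\<close> has at least one subsum more than
  elements, and \<open>card_subsums_add\<close> loses only one.\<close>

lemma card_subsums_extend:
  assumes "m > 0" "zero_sum_free m M" "A \<subseteq># M"
  shows "card (subsums m A) + size M \<le> card (subsums m M) + size A"
proof -
  obtain B where B: "M = A + B" using assms(3) by (metis subset_mset.add_diff_inverse)
  have "zero_sum_free m B" using assms(2) by (rule zero_sum_free_mono) (simp add: B)
  from card_subsums_ge_size[OF assms(1) this] card_subsums_add[of m A B] assms B
  show ?thesis by simp
qed

section \<open>Subsums of two, three and four distinct residues\<close>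

lemma int_not_dvd_diff:
  fixes a b m :: nat
  assumes "a \<noteq> b" "a < m" "b < m"
  shows "\<not> int m dvd int a - int b"
  using assms by (metis mod_eq_iff_int_dvd mod_less)

lemma card_subsums_pair:
  assumes "m > 0" "zero_sum_free m {#a, b#}" "a \<noteq> b" "a < m" "b < m"
  shows "card (subsums m {#a, b#}) \<ge> 4"
proof -
  note nz = zero_sum_free_not_dvd[OF assms(2)]
  show ?thesis
    using card_subsums_ge_length[of m "[{#a, b#}, {#a#}, {#b#}, {#}]" "{#a, b#}"]
      assms nz[of "{#a#}"] nz[of "{#b#}"] nz[of "{#a, b#}"] int_not_dvd_diff[of a b m] by simp
qed

text \<open>All eight subsums differ: after cancelling, a coincidence is a vanishing nonempty
  subsum, an equality of two elements, or an element that is the sum of the other two.\<close>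

lemma card_subsums_triple_generic:
  assumes "m > 0" "zero_sum_free m {#a, b, c#}" "distinct [a, b, c]" "{a, b, c} \<subseteq> {..<m}"
    and "\<not> [a = b + c] (mod m)" "\<not> [b = a + c] (mod m)" "\<not> [c = a + b] (mod m)"
  shows "card (subsums m {#a, b, c#}) \<ge> 8"
proof -
  note nz = zero_sum_free_not_dvd[OF assms(2)]
  have sub: "{#a#} \<subseteq># {#a, b, c#}" "{#b#} \<subseteq># {#a, b, c#}" "{#c#} \<subseteq># {#a, b, c#}"
    "{#a, b#} \<subseteq># {#a, b, c#}" "{#a, c#} \<subseteq># {#a, b, c#}" "{#b, c#} \<subseteq># {#a, b, c#}"
    using assms(3) by (auto simp: subseteq_mset_def)
  have ne: "\<not> int m dvd int b + int c - int a" "\<not> int m dvd int a + int c - int b"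
     "\<not> int m dvd int a + int b - int c"
    using assms(5-7) by (metis cong_iff_dvd_diff cong_int_iff cong_sym of_nat_add)+
  have d: "\<not> int m dvd int a - int b" "\<not> int m dvd int a - int c" "\<not> int m dvd int b - int c"
    using assms(3,4) int_not_dvd_diff[of _ _ m] by auto
  show ?thesis
    using card_subsums_ge_length[of m "[{#a, b, c#}, {#a, b#}, {#a, c#}, {#b, c#}, {#a#}, {#b#}, {#c#}, {#}]" "{#a, b, c#}"]
      assms(1) nz[OF sub(1)] nz[OF sub(2)] nz[OF sub(3)] nz[OF sub(4)] nz[OF sub(5)] nz[OF sub(6)] ne d
      nz[of "{#a, b, c#}"] sub
    by (simp add: algebra_simps)
qed

lemma cong_iff_int_dvd:
  "[c = a + b] (mod m) \<longleftrightarrow> int m dvd int a + int b - int c"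
  by (metis cong_iff_dvd_diff cong_int_iff cong_sym_eq of_nat_add)

lemma card_subsums_triple_ge_6:
  assumes "m > 0" "zero_sum_free m {#a, b, c#}" "distinct [a, b, c]" "{a, b, c} \<subseteq> {..<m}"
    and "\<not> [b = a + c] (mod m)"
  shows "card (subsums m {#a, b, c#}) \<ge> 6"
proof -
  note nz = zero_sum_free_not_dvd[OF assms(2)]
  have sub: "{#a#} \<subseteq># {#a, b, c#}" "{#b#} \<subseteq># {#a, b, c#}" "{#c#} \<subseteq># {#a, b, c#}"
    "{#a, b#} \<subseteq># {#a, b, c#}" "{#a, c#} \<subseteq># {#a, b, c#}" "{#b, c#} \<subseteq># {#a, b, c#}"
    using assms(3) by (auto simp: subseteq_mset_def)
  have d: "\<not> int m dvd int a - int b" "\<not> int m dvd int c - int a" "\<not> int m dvd int c - int b"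
    using assms(3,4) int_not_dvd_diff[of _ _ m] by auto
  show ?thesis
    \<comment> \<open>The lemma is meant for \<open>c = a + b\<close>, so \<open>{#a, b#}\<close> is
      left out. \<open>{#b, c#}\<close> is left out too, as it may collide with \<open>a\<close>;
      \<open>card_subsums_triple_ge_7\<close> excludes this and gains it back.\<close>
    using card_subsums_ge_length[of m "[{#a, b, c#}, {#a, c#}, {#c#}, {#a#}, {#b#}, {#}]" "{#a, b, c#}"]
      assms(1,5) nz[OF sub(1)] nz[OF sub(2)] nz[OF sub(3)] nz[OF sub(4)] nz[OF sub(5)] nz[OF sub(6)] d
      nz[of "{#a, b, c#}"] sub
    by (simp add: algebra_simps cong_iff_int_dvd)
qed

lemma card_subsums_triple_ge_7:
  assumes "m > 0" "zero_sum_free m {#a, b, c#}" "distinct [a, b, c]" "{a, b, c} \<subseteq> {..<m}"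
    and "\<not> [b = a + c] (mod m)" "\<not> [a = b + c] (mod m)"
  shows "card (subsums m {#a, b, c#}) \<ge> 7"
proof -
  note nz = zero_sum_free_not_dvd[OF assms(2)]
  have sub: "{#a#} \<subseteq># {#a, b, c#}" "{#b#} \<subseteq># {#a, b, c#}" "{#c#} \<subseteq># {#a, b, c#}"
    "{#a, b#} \<subseteq># {#a, b, c#}" "{#a, c#} \<subseteq># {#a, b, c#}" "{#b, c#} \<subseteq># {#a, b, c#}"
    using assms(3) by (auto simp: subseteq_mset_def)
  have d: "\<not> int m dvd int a - int b" "\<not> int m dvd int c - int a" "\<not> int m dvd int c - int b"
    using assms(3,4) int_not_dvd_diff[of _ _ m] by auto
  show ?thesis
    using card_subsums_ge_length[of m "[{#a, b, c#}, {#a, c#}, {#b, c#}, {#c#}, {#a#}, {#b#}, {#}]" "{#a, b, c#}"]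
      assms(1,5,6) nz[OF sub(1)] nz[OF sub(2)] nz[OF sub(3)] nz[OF sub(4)] nz[OF sub(5)] nz[OF sub(6)] d
      nz[of "{#a, b, c#}"] sub
    by (simp add: algebra_simps cong_iff_int_dvd)
qed

text \<open>The seven subsums of the related triple \<open>a, b, c\<close> are joined by
  \<open>a + b + d\<close>, which equals \<open>c + d\<close> modulo \<open>m\<close>, and by the
  total \<open>a + b + c + d\<close>.\<close>

lemma card_subsums_quadruple_ge_9:
  assumes "m > 0" "zero_sum_free m {#a, b, c, d#}" "distinct [a, b, c, d]" "{a, b, c, d} \<subseteq> {..<m}"
    and "[c = a + b] (mod m)" "\<not> [b = a + c] (mod m)" "\<not> [a = b + c] (mod m)"
  shows "card (subsums m {#a, b, c, d#}) \<ge> 9"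
proof -
  let ?M = "{#a, b, c, d#}"
  have nz: "\<not> int m dvd int (sum_mset N)" "N \<subseteq># ?M" if "N \<in> {{#a#}, {#b#}, {#c#}, {#d#}, {#a, b#}, {#a, c#},
    {#a, d#}, {#b, c#}, {#b, d#}, {#c, d#}, {#a, b, c#}, {#a, b, d#}, {#a, c, d#}, {#b, c, d#}, {#a, b, c, d#}}" for N
  proof -
    show "N \<subseteq># ?M" using that assms(3) by (auto simp: subseteq_mset_def)
    thus "\<not> int m dvd int (sum_mset N)"
      by (rule zero_sum_free_not_dvd[OF assms(2)]) (use that in auto)
  qed
  have df: "\<not> int m dvd int a - int b" "\<not> int m dvd int c - int a" "\<not> int m dvd int c - int b"
     "\<not> int m dvd int d - int a" "\<not> int m dvd int d - int b" "\<not> int m dvd int d - int c"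
    using assms(3,4) int_not_dvd_diff[of _ _ m] by auto
  have c: "int m dvd int a + int b - int c"
    using assms(5) by (simp add: cong_iff_int_dvd)
  \<comment> \<open>Subtracting the multiple \<open>a + b - c\<close> of \<open>m\<close> turns
    these differences into \<open>d - a\<close>, \<open>d - b\<close> and \<open>d\<close>.\<close>
  have e: "\<not> int m dvd int b + int d - int c" "\<not> int m dvd int a + int d - int c" "\<not> int m dvd int a + int b + int d - int c"
    using dvd_diff[OF _ c, of "int b + int d - int c"] dvd_diff[OF _ c, of "int a + int d - int c"]
      dvd_diff[OF _ c, of "int a + int b + int d - int c"] df nz(1)[of "{#d#}"]
    by (auto simp: algebra_simps)
  show ?thesis
    using card_subsums_ge_length[of m "[{#a, b, c, d#}, {#a, b, d#}, {#a, b, c#}, {#a, c#}, {#b, c#}, {#c#}, {#a#}, {#b#}, {#}]" ?M]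
      assms(1,6,7) df e nz[of "{#a#}"] nz[of "{#b#}"] nz[of "{#c#}"] nz[of "{#d#}"]
       nz[of "{#a, b#}"] nz[of "{#a, c#}"] nz[of "{#a, d#}"] nz[of "{#b, c#}"] nz[of "{#b, d#}"] nz[of "{#c, d#}"]
       nz[of "{#a, b, c#}"] nz[of "{#a, b, d#}"] nz[of "{#a, c, d#}"] nz[of "{#b, c, d#}"] nz[of "{#a, b, c, d#}"]
    by (simp add: algebra_simps cong_iff_int_dvd)
qed

lemma double_eq_modulus:
  fixes a m :: nat
  assumes "a \<in> {1..<m}" "m dvd 2 * a"
  shows "2 * a = m"
proof -
  obtain k where k: "2 * a = m * k" using assms(2) by (elim dvdE)
  have "k = 1"
  proof (rule ccontr)
    assume "k \<noteq> 1"
    moreover have "k \<noteq> 0" using k assms(1) by (cases "k = 0") auto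
    ultimately have "m * 2 \<le> m * k" by (intro mult_le_mono2) linarith
    hence "m * 2 \<le> 2 * a" by (simp only: k)
    thus False using assms(1) by simp
  qed
  with k show ?thesis by simp
qed

text \<open>Adding the congruences cancels \<open>b\<close> and \<open>c\<close>. Hence two
  relations within one triple force an involution, that is, an element with
  \<open>2 * a = m\<close>.\<close>

lemma cong_add_swap_imp_double:
  assumes "[c = a + b] (mod m)" "[b = a + c] (mod m)"
  shows "m dvd 2 * (a::nat)"
proof -
  have "int m dvd (int a + int b - int c) + (int a + int c - int b)"
    using assms by (intro dvd_add) (auto simp: cong_iff_int_dvd)
  hence "int m dvd int (2 * a)" by simp
  thus ?thesis unfolding int_dvd_int_iff .
qed

text \<open>Either no element is the sum of the other two, or the elements can be renamed so that
  the relation reads \<open>c = a + b\<close>.\<close>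

lemma card_3_cases:
  assumes "m > 0" "A \<subseteq> {1..<m}" "card A = 3" "zero_sum_free m (mset_set A)"
  obtains "card (subsums m (mset_set A)) \<ge> 8"
  | a b c where "A = {a, b, c}" "distinct [a, b, c]" "[c = a + b] (mod m)"
proof -
  obtain a b c where A: "A = {a, b, c}" "distinct [a, b, c]"
    using assms(3) by (auto simp: card_3_iff)
  hence eq: "mset_set A = {#a, b, c#}" by simp
  consider "[c = a + b] (mod m)" | "[b = a + c] (mod m)" | "[a = b + c] (mod m)"
    | "\<not> [a = b + c] (mod m)" "\<not> [b = a + c] (mod m)" "\<not> [c = a + b] (mod m)" by blast
  thus ?thesis
  proof cases
    case 1 show ?thesis by (rule that(2)[OF _ _ 1]) (use A in auto)
  next
    case 2 show ?thesis by (rule that(2)[OF _ _ 2]) (use A in auto)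
  next
    case 3 show ?thesis by (rule that(2)[OF _ _ 3]) (use A in auto)
  next
    case 4
    have "card (subsums m {#a, b, c#}) \<ge> 8"
      by (rule card_subsums_triple_generic) (use A 4 assms eq in auto)
    thus ?thesis using that(1) eq by simp
  qed
qed

text \<open>Beside \<open>c = a + b\<close>, not both remaining relations hold, since they would
  make both \<open>a\<close> and \<open>b\<close> equal to half of \<open>m\<close>. Swapping
  \<open>a\<close> and \<open>b\<close> if necessary leads to
  \<open>card_subsums_triple_ge_6\<close>.\<close>

lemma card_subsums_3_ge_6:
  assumes "m > 0" "A \<subseteq> {1..<m}" "card A = 3" "zero_sum_free m (mset_set A)"
  shows "card (subsums m (mset_set A)) \<ge> 6"
  using assms
proof (cases rule: card_3_cases)
  case (2 a b c)
  have *: ?thesis if "A = {a, b, c}" "distinct [a, b, c]" "\<not> [b = a + c] (mod m)" for a b c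
  proof -
    have eq: "mset_set A = {#a, b, c#}" using that by simp
    show ?thesis unfolding eq
      by (rule card_subsums_triple_ge_6) (use that assms eq in auto)
  qed
  show ?thesis
  proof (cases "[b = a + c] (mod m) \<and> [a = b + c] (mod m)")
    case True
    hence "m dvd 2 * a" "m dvd 2 * b"
      using cong_add_swap_imp_double[of c a b m] cong_add_swap_imp_double[of c b a m] 2
      by (auto simp: add.commute)
    moreover have "a \<in> {1..<m}" "b \<in> {1..<m}" using assms(2) 2 by auto
    ultimately have "2 * a = m" "2 * b = m" using double_eq_modulus by blast+
    thus ?thesis using 2 by auto
  next
    case False
    thus ?thesis using *[of a b c] *[of b a c] 2 by (auto simp: insert_commute)
  qed
qed auto

lemma card_subsums_3_ge_7:
  assumes "m > 0" "A \<subseteq> {1..<m}" "card A = 3" "zero_sum_free m (mset_set A)"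
    and "\<forall>a\<in>A. 2 * a \<noteq> m"
  shows "card (subsums m (mset_set A)) \<ge> 7"
  using assms(1-4)
proof (cases rule: card_3_cases)
  case (2 a b c)
  have eq: "mset_set A = {#a, b, c#}" using 2 by simp
  show ?thesis unfolding eq
  proof (rule card_subsums_triple_ge_7)
    show "\<not> [b = a + c] (mod m)" "\<not> [a = b + c] (mod m)"
      using cong_add_swap_imp_double[of c a b m] cong_add_swap_imp_double[of c b a m]
        2 assms(2,5) double_eq_modulus[of a m] double_eq_modulus[of b m]
      by (auto simp: add.commute)
  qed (use 2 assms eq in auto)
qed auto

section \<open>Subsums of zero-sum free sets of any size\<close>

lemma mset_set_split: "finite A \<Longrightarrow> B \<subseteq> A \<Longrightarrow> mset_set A = mset_set B + mset_set (A - B)"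
  by (metis Diff_disjoint Un_Diff_cancel finite_Diff finite_subset mset_set_Union sup.absorb2)

lemma card_subsums_set_split:
  assumes "m > 0" "finite A" "B \<subseteq> A" "zero_sum_free m (mset_set A)"
  shows "card (subsums m (mset_set B)) + card (subsums m (mset_set (A - B))) \<le> card (subsums m (mset_set A)) + 1"
  using card_subsums_add[of m "mset_set B" "mset_set (A - B)"] assms
  by (simp flip: mset_set_split)

text \<open>Only \<open>m div 2\<close> can be an involution, so discarding this one value
  suffices.\<close>

lemma obtain_non_involutions:
  assumes "finite A" "n < card A"
  obtains B where "B \<subseteq> A" "card B = n" "\<forall>a\<in>B. 2 * a \<noteq> (m::nat)"
proof -
  have "card (A - {m div 2}) \<ge> n" using assms by (auto simp: card_Diff_singleton_if)
  then obtain B where "B \<subseteq> A - {m div 2}" "card B = n"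
    by (metis obtain_subset_with_card_n)
  thus ?thesis by (intro that) auto
qed

text \<open>A triple without involution is split off: it has seven subsums and Scherk's theorem
  costs one, which leaves a net gain of two per element.\<close>

lemma card_subsums_set_ge:
  assumes "m > 0" "finite A" "A \<noteq> {}" "A \<subseteq> {1..<m}" "zero_sum_free m (mset_set A)"
  shows "card (subsums m (mset_set A)) \<ge> 2 * card A"
  using assms(2-)
proof (induction "card A" arbitrary: A rule: less_induct)
  case less
  have "card A \<noteq> 0" using less.prems by simp
  then consider "card A = 1" | "card A = 2" | "card A = 3" | "card A \<ge> 4" by linarith
  thus ?case
  proof cases
    case 1
    thus ?thesis using card_subsums_ge_size[OF \<open>m > 0\<close> less.prems(4)] by simp
  next
    case 2
    then obtain a b where A: "A = {a, b}" "a \<noteq> b" by (auto simp: card_2_iff)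
    thus ?thesis using card_subsums_pair[of m a b] less.prems \<open>m > 0\<close> by simp
  next
    case 3
    thus ?thesis using card_subsums_3_ge_6[of m A] less.prems \<open>m > 0\<close> by simp
  next
    case 4
    then obtain B where B: "B \<subseteq> A" "card B = 3" "\<forall>a\<in>B. 2 * a \<noteq> m"
      using obtain_non_involutions[of A 3 m] less.prems by auto
    have sp: "mset_set A = mset_set B + mset_set (A - B)"
      by (rule mset_set_split) (use less.prems B in auto)
    have c: "card (A - B) = card A - 3" using B less.prems by (simp add: card_Diff_subset finite_subset)
    have z: "zero_sum_free m (mset_set B)" "zero_sum_free m (mset_set (A - B))"
      using less.prems(4) unfolding sp by (auto elim: zero_sum_free_mono)
    have "card (subsums m (mset_set B)) \<ge> 7"
      by (rule card_subsums_3_ge_7) (use B z less.prems \<open>m > 0\<close> in auto)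
    moreover have "card (subsums m (mset_set (A - B))) \<ge> 2 * card (A - B)"
    proof (rule less.hyps)
      show "A - B \<noteq> {}"
      proof
        assume "A - B = {}"
        with c 4 show False by simp
      qed
    qed (use c 4 z less.prems in auto)
    ultimately show ?thesis
      using card_subsums_set_split[OF \<open>m > 0\<close> less.prems(1) B(1) less.prems(4)] c 4 by linarith
  qed
qed

text \<open>If every triple had a relation, start with \<open>c = a + b\<close>. The triple
  \<open>a, b, d\<close> then needs \<open>a = b + d\<close> or \<open>b = a + d\<close>, because
  \<open>d = a + b\<close> would give \<open>c = d\<close>. Both options clash with the triple
  containing \<open>c\<close>, \<open>d\<close> and the element so expressed.\<close>

lemma obtain_triple_card_subsums_ge_8:
  assumes "m > 0" "A \<subseteq> {1..<m}" "card A = 4" "zero_sum_free m (mset_set A)" "\<forall>a\<in>A. 2 * a \<noteq> m"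
  obtains B where "B \<subseteq> A" "card B = 3" "card (subsums m (mset_set B)) \<ge> 8"
proof -
  have False if none: "\<And>B. B \<subseteq> A \<Longrightarrow> card B = 3 \<Longrightarrow> card (subsums m (mset_set B)) < 8"
  proof -
    have finA: "finite A" using assms(3) by (simp add: card_ge_0_finite)
    have zB: "zero_sum_free m (mset_set B)" if "B \<subseteq> A" for B
      using zero_sum_free_mono[OF assms(4)] mset_set_split[OF finA that] by simp
    have relation: "[a = b + c] (mod m) \<or> [b = a + c] (mod m) \<or> [c = a + b] (mod m)"
      if "{a, b, c} \<subseteq> A" "distinct [a, b, c]" for a b c
    proof (rule ccontr)
      assume rel: "\<not> ?thesis"
      have eq: "mset_set {a, b, c} = {#a, b, c#}" using that(2) by simp
      have "card (subsums m {#a, b, c#}) \<ge> 8"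
        by (rule card_subsums_triple_generic) (use that rel assms(1,2) zB[OF that(1)] eq in auto)
      thus False using none[OF that(1)] that(2) eq by simp
    qed
    \<comment> \<open>The three possible relations among \<open>a, c, d\<close> give in turn
      \<open>b = c\<close>, \<open>b = d\<close> and \<open>b + c = 0\<close> modulo
      \<open>m\<close>.\<close>
    have no_three: False
      if "{a, b, c, d} \<subseteq> A" "distinct [a, b, c, d]" "[c = a + b] (mod m)" "[a = b + d] (mod m)" for a b c d
    proof -
      have P: "int m dvd int a + int b - int c" and Q: "int m dvd int b + int d - int a"
        using that(3,4) by (simp_all add: cong_iff_int_dvd)
      have "b < m" "c < m" "d < m" using that(1) assms(2) by auto
      hence "\<not> int m dvd int b - int c" "\<not> int m dvd int b - int d"
        using int_not_dvd_diff[of _ _ m] that(2) by auto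
      moreover have "\<not> int m dvd int b + int c"
        using zero_sum_free_not_dvd[OF zB[of "{b, c}"], of "{#b, c#}"] that(1,2) by simp
      moreover have "int m dvd int c + int d - int a \<or> int m dvd int a + int d - int c \<or> int m dvd int a + int c - int d"
        using relation[of a c d] that(1,2) by (simp add: cong_iff_int_dvd)
      ultimately show False
        using dvd_diff[OF Q, of "int c + int d - int a"] dvd_diff[OF P, of "int a + int d - int c"]
          dvd_add[OF Q, of "int a + int c - int d"] by (auto simp: algebra_simps)
    qed
    obtain a' A' where A': "A = insert a' A'" "a' \<notin> A'" "card A' = 3"
      using assms(3) by (metis card_Suc_eq numeral_eq_Suc pred_numeral_simps(2) semiring_norm(26,27))
    then obtain x y z where xyz: "A' = {x, y, z}" "distinct [x, y, z]" by (auto simp: card_3_iff)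
    have sum_case: False if *: "A = {a, b, c, d}" "distinct [a, b, c, d]" "[c = a + b] (mod m)" for a b c d
    proof -
      have "\<not> [d = a + b] (mod m)"
      proof
        assume "[d = a + b] (mod m)"
        hence "[c = d] (mod m)" using *(3) cong_sym cong_trans by blast
        thus False using * assms(2) by (auto simp: cong_def)
      qed
      hence "[a = b + d] (mod m) \<or> [b = a + d] (mod m)"
        using relation[of a b d] * by auto
      thus False
        using no_three[of a b c d] no_three[of b a c d] * by (auto simp: add.commute)
    qed
    have "[x = y + z] (mod m) \<or> [y = x + z] (mod m) \<or> [z = x + y] (mod m)"
      using relation[of x y z] A' xyz by auto
    thus False
      using sum_case[of y z x a'] sum_case[of x z y a'] sum_case[of x y z a'] A' xyz
      by (auto simp: insert_commute)
  qed
  thus thesis using that not_less by blast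
qed

text \<open>A triple with eight subsums yields the extra one, as
  \<open>8 + 2 * (card A - 3) - 1 = 2 * card A + 1\<close>. With five or more elements, four
  non-involutions supply such a triple. With exactly four, only three non-involutions are
  guaranteed; if they are related, the quadruple bound \<open>9\<close> applies.\<close>

lemma card_subsums_set_ge_Suc:
  assumes "m > 0" "A \<subseteq> {1..<m}" "card A \<ge> 4" "zero_sum_free m (mset_set A)"
  shows "card (subsums m (mset_set A)) \<ge> 2 * card A + 1"
proof -
  have finA: "finite A" using assms(2) finite_subset by blast
  have z: "zero_sum_free m (mset_set B)" if "B \<subseteq> A" for B
    using zero_sum_free_mono[OF assms(4)] mset_set_split[OF finA that] by simp
  have big_triple: ?thesis if B: "B \<subseteq> A" "card B = 3" "card (subsums m (mset_set B)) \<ge> 8"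
  for B
  proof -
    have c: "card (A - B) = card A - 3"
      using B finA by (simp add: card_Diff_subset finite_subset)
    have "A - B \<noteq> {}"
    proof
      assume "A - B = {}"
      with c assms(3) show False by simp
    qed
    hence "card (subsums m (mset_set (A - B))) \<ge> 2 * card (A - B)"
      by (intro card_subsums_set_ge) (use assms finA z in auto)
    thus ?thesis
      using card_subsums_set_split[OF assms(1) finA B(1) assms(4)] B c assms(3) by linarith
  qed
  show ?thesis
  proof (cases "card A = 4")
    case True
    then obtain B where B: "B \<subseteq> A" "card B = 3" "\<forall>a\<in>B. 2 * a \<noteq> m"
      using obtain_non_involutions[of A 3 m] finA by auto
    have "B \<subseteq> {1..<m}" using B(1) assms(2) by blast
    from assms(1) this B(2) z[OF B(1)] show ?thesis
    proof (cases rule: card_3_cases)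
      case 1
      thus ?thesis using big_triple B by blast
    next
      case (2 a b c)
      have "card (A - B) = 1" using True B finA by (simp add: card_Diff_subset finite_subset)
      then obtain d where "A - B = {d}" by (auto simp: card_1_singleton_iff)
      hence d: "A = {a, b, c, d}" "d \<notin> B" using B(1) 2 by auto
      have eq: "mset_set A = {#a, b, c, d#}" using d 2 by simp
      have "card (subsums m {#a, b, c, d#}) \<ge> 9"
      proof (rule card_subsums_quadruple_ge_9)
        show "\<not> [b = a + c] (mod m)" "\<not> [a = b + c] (mod m)"
          using cong_add_swap_imp_double[of c a b m] cong_add_swap_imp_double[of c b a m]
            2 \<open>B \<subseteq> {1..<m}\<close> B(3) double_eq_modulus[of a m] double_eq_modulus[of b m]
          by (auto simp: add.commute)
      qed (use 2 d assms eq in auto)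
      thus ?thesis using eq True by simp
    qed
  next
    case False
    then obtain C where C: "C \<subseteq> A" "card C = 4" "\<forall>a\<in>C. 2 * a \<noteq> m"
      using obtain_non_involutions[of A 4 m] finA assms(3) by auto
    have "C \<subseteq> {1..<m}" using C(1) assms(2) by blast
    from assms(1) this C(2) z[OF C(1)] C(3) obtain B
      where "B \<subseteq> C" "card B = 3" "card (subsums m (mset_set B)) \<ge> 8"
      by (rule obtain_triple_card_subsums_ge_8)
    thus ?thesis using big_triple C(1) by blast
  qed
qed

subsection \<open>Minimal zero-sum multisets\<close>

definition minimal_zero_sum :: "nat \<Rightarrow> nat multiset \<Rightarrow> bool" where
  "minimal_zero_sum m M \<longleftrightarrow> M \<noteq> {#} \<and> m dvd sum_mset M \<and>
     (\<forall>N. N \<subseteq># M \<longrightarrow> N \<noteq> {#} \<longrightarrow> m dvd sum_mset N \<longrightarrow> N = M)"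

lemma minimal_zero_sum_eq:
  "minimal_zero_sum m M \<Longrightarrow> N \<subseteq># M \<Longrightarrow> N \<noteq> {#} \<Longrightarrow> m dvd sum_mset N \<Longrightarrow> N = M"
  by (auto simp: minimal_zero_sum_def)

lemma zero_sum_free_if_proper:
  assumes "minimal_zero_sum m M" "A \<subset># M"
  shows "zero_sum_free m A"
  unfolding zero_sum_free_def
proof (intro allI impI)
  fix N assume N: "N \<subseteq># A" "m dvd sum_mset N"
  hence "N \<subset># M" using assms(2) by (meson subset_mset.le_less_trans)
  thus "N = {#}" using minimal_zero_sum_eq[OF assms(1), of N] N(2) by (auto simp: subset_mset.less_le)
qed

text \<open>Removing one element \<open>g\<close> outside \<open>A\<close> leaves a zero-sum free
  multiset, which has at most \<open>m\<close> subsums; each of its elements beyond \<open>A\<close>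
  accounts for at least one of them.\<close>

lemma card_subsums_proper_le:
  assumes "m > 0" "minimal_zero_sum m M" "A \<subset># M"
  shows "card (subsums m A) + size M \<le> m + 1 + size A"
proof -
  obtain C where C: "M = A + C" using assms(3)
    by (metis subset_mset.add_diff_inverse subset_mset.less_imp_le)
  hence "C \<noteq> {#}" using assms(3) by auto
  then obtain g D where D: "C = add_mset g D" by (metis multiset_cases)
  have "zero_sum_free m (A + D)"
    by (rule zero_sum_free_if_proper[OF assms(2)]) (simp add: C D subset_mset.less_le)
  from card_subsums_extend[OF assms(1) this, of A] card_subsums_le[OF assms(1), of "A + D"]
  show ?thesis by (simp add: C D)
qed

section \<open>The width is at most two\<close>

lemma multiset_eq_mset_set:
  assumes "size M = card (set_mset M)"
  shows "M = mset_set (set_mset M)"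
proof -
  have "mset_set (set_mset M) \<subseteq># M" by (rule mset_set_set_mset_msubset)
  thus ?thesis using assms
    by (metis mset_subset_size size_mset_set subset_mset.le_less nat_neq_iff)
qed

text \<open>When all multiplicities are 1, half of the nonzero residues occur, so some \<open>x\<close> occurs
  together with \<open>-x\<close>.\<close>
lemma multiplicity_if_extremal:
  assumes "minimal_zero_sum m M" "set_mset M \<subseteq> {1..<m}"
    and "size M + card (set_mset M) = m + 1" "card (set_mset M) \<noteq> 2"
  shows "mset_set (set_mset M) \<subset># M"
proof (rule ccontr)
  assume "\<not> ?thesis"
  hence M: "M = mset_set (set_mset M)"
    using mset_set_set_mset_msubset[of M] by (simp add: subset_mset.less_le)
  define S where "S = set_mset M"
  have sz: "2 * card S = m + 1"
    using assms(3) M by (metis S_def mult_2 size_mset_set)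
  have S: "finite S" "S \<subseteq> {1..<m}" using assms(2) by (auto simp: S_def)
  have "inj_on (\<lambda>x. m - x) S"
  proof (rule inj_onI)
    fix x y assume "x \<in> S" "y \<in> S" and eq: "m - x = m - y"
    hence "x < m" "y < m" using S(2) by auto
    thus "x = y" using eq by linarith
  qed
  hence c: "card ((\<lambda>x. m - x) ` S) = card S" by (rule card_image)
  have "S \<inter> (\<lambda>x. m - x) ` S \<noteq> {}"
  proof
    assume "S \<inter> (\<lambda>x. m - x) ` S = {}"
    hence "card (S \<union> (\<lambda>x. m - x) ` S) = 2 * card S"
      using S c by (simp add: card_Un_disjoint)
    moreover have "m - x \<in> {1..<m}" if "x \<in> S" for x using subsetD[OF S(2) that] by auto
    hence "S \<union> (\<lambda>x. m - x) ` S \<subseteq> {1..<m}" using S(2) by blast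
    hence "card (S \<union> (\<lambda>x. m - x) ` S) \<le> m - 1"
      using card_mono[of "{1..<m}"] by fastforce
    ultimately show False using sz by linarith
  qed
  then obtain x y where xy: "x \<in> S" "y \<in> S" "x = m - y" by auto
  hence sum: "x + y = m" using S(2) by auto
  \<comment> \<open>By \<open>sz\<close> the modulus is odd, so \<open>x\<close> is not its own
    negative.\<close>
  hence "x \<noteq> y" using sz by presburger
  hence "{#x, y#} \<subseteq># M"
    using xy unfolding S_def by (subst M) (auto simp: subseteq_mset_def)
  hence "{#x, y#} = M" using minimal_zero_sum_eq[OF assms(1)] sum by simp
  thus False using assms(4) \<open>x \<noteq> y\<close> by auto
qed

text \<open>Adding \<open>h + b - c\<close> to the vanishing total
  \<open>h + c + (m - 4) * b\<close> eliminates \<open>c\<close> and, by \<open>2 * h = m\<close>,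
  also \<open>h\<close>; what remains is \<open>3 * b = 0\<close> modulo \<open>m\<close>. As
  \<open>m - 4\<close> is at least 3, three copies of \<open>b\<close> are already a zero-sum
  submultiset.\<close>

lemma no_extremal_with_involution_aux:
  assumes M: "minimal_zero_sum m M" and "M = {#h, c#} + replicate_mset (m - 4) b"
    and "2 * h = m" "[c = h + b] (mod m)" "m \<ge> 7" "h \<noteq> b"
  shows False
proof -
  have "m dvd sum_mset M" using M by (simp add: minimal_zero_sum_def)
  hence "int m dvd int (sum_mset M)" unfolding int_dvd_int_iff .
  hence 1: "int m dvd int h + int c + (int m - 4) * int b"
    using assms(2,5) by (simp add: of_nat_diff add.assoc)
  have 2: "int m dvd int h + int b - int c"
    using assms(4) by (simp add: cong_iff_int_dvd)
  have eq: "int h + int c + (int m - 4) * int b + (int h + int b - int c) = int m * (1 + int b) - int (3 * b)"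
    using assms(3) by (simp add: algebra_simps flip: of_nat_add)
  have "int m dvd int m * (1 + int b) - int (3 * b)" using dvd_add[OF 1 2] unfolding eq .
  hence "int m dvd int (3 * b)" by (metis dvd_diff_commute dvd_triv_left zdvd_zdiffD)
  hence d: "m dvd 3 * b" unfolding int_dvd_int_iff .
  have "replicate_mset 3 b \<subseteq># replicate_mset (m - 4) b"
    using assms(5) by (simp add: replicate_mset_msubseteq_iff)
  hence "replicate_mset 3 b \<subseteq># M" unfolding assms(2) by (rule subset_mset.order_trans) simp
  hence "replicate_mset 3 b = M" using minimal_zero_sum_eq[OF M] d by simp
  moreover have "h \<in># M" using assms(2) by simp
  ultimately show False using assms(6) by (metis in_replicate_mset)
qed

text \<open>The involution \<open>h\<close> occurs once, as two copies sum to zero. Since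
  \<open>2 * h = m\<close>, the relation is symmetric in \<open>b\<close> and \<open>c\<close>, so
  the previous lemma covers either of them occurring once. Otherwise \<open>{h, b, c, b, c}\<close>
  has too many subsums.\<close>

lemma no_extremal_with_involution:
  assumes M: "minimal_zero_sum m M" and set: "set_mset M = {h, b, c}" and dist: "distinct [h, b, c]"
    and "set_mset M \<subseteq> {1..<m}" "2 * h = m" "[c = h + b] (mod m)" "size M + 2 = m" "m \<noteq> 6"
    and proper: "mset_set (set_mset M) \<subset># M"
  shows False
proof -
  have "count M h = 1"
  proof (rule ccontr)
    assume "count M h \<noteq> 1"
    moreover have "count M h > 0" using set by (simp add: count_greater_zero_iff)
    ultimately have "2 \<le> count M h" by linarith
    hence "replicate_mset 2 h \<subseteq># M" by (simp only: count_le_replicate_mset_subset_eq)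
    hence "replicate_mset 2 h = M" using minimal_zero_sum_eq[OF M] assms(5) by simp
    hence "set_mset M = {h}" by (metis set_mset_replicate_mset_subset zero_neq_numeral)
    thus False using set dist by auto
  qed
  define p q where "p = count M b" and "q = count M c"
  have pq: "p > 0" "q > 0" using set by (simp_all add: p_def q_def count_greater_zero_iff)
  have Meq: "M = {#h#} + (replicate_mset p b + replicate_mset q c)"
  proof (rule multiset_eqI)
    fix x show "count M x = count ({#h#} + (replicate_mset p b + replicate_mset q c)) x"
      using set dist \<open>count M h = 1\<close> not_in_iff[of x M] by (auto simp: p_def q_def)
  qed
  have sz: "p + q + 3 = m" using assms(7) Meq by simp
  have "m > 0" using sz by simp
  have "p + q \<noteq> 2"
  proof
    assume "p + q = 2"
    hence "size M = card (set_mset M)" using set dist Meq by simp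
    thus False using multiset_eq_mset_set proper by (metis subset_mset.less_irrefl)
  qed
  \<comment> \<open>\<open>p + q = 2\<close> was the case \<open>m = 5\<close>, and
    \<open>m = 6\<close> is excluded by hypothesis.\<close>
  hence m7: "m \<ge> 7" using sz assms(8) pq by linarith
  have b: "[b = h + c] (mod m)"
  proof -
    have "int m dvd int h + int b - int c" using assms(6) by (simp add: cong_iff_int_dvd)
    hence "int m dvd int m - (int h + int b - int c)" by (rule dvd_diff[OF dvd_refl])
    moreover have "int m - (int h + int b - int c) = int h + int c - int b" using assms(5) by simp
    ultimately show ?thesis by (simp add: cong_iff_int_dvd)
  qed
  consider "p = 1" | "q = 1" | "p \<ge> 2" "q \<ge> 2" using pq by linarith
  thus False
  proof cases
    case 1
    show False
      by (rule no_extremal_with_involution_aux[OF M _ assms(5) b m7])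
         (use Meq 1 sz dist in \<open>auto simp: eval_nat_numeral\<close>)
  next
    case 2
    show False
      by (rule no_extremal_with_involution_aux[OF M _ assms(5,6) m7])
         (use Meq 2 sz dist in \<open>auto simp: eval_nat_numeral\<close>)
  next
    case 3
    let ?N = "{#h, b, c#} + {#b, c#}"
    have "?N \<subseteq># M" using 3 dist set \<open>count M h = 1\<close> by (auto simp: subseteq_mset_def p_def q_def)
    \<comment> \<open>Equality would give \<open>m = 7\<close>, but \<open>m\<close> is
      even.\<close>
    moreover have "?N \<noteq> M"
    proof
      assume "?N = M"
      from this[symmetric] assms(7) have "m = 7" by simp
      thus False using assms(5) by presburger
    qed
    ultimately have N: "?N \<subset># M" by (simp add: subset_mset.less_le)
    have z: "zero_sum_free m ?N" by (rule zero_sum_free_if_proper[OF M N])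
    have z3: "zero_sum_free m {#h, b, c#}" by (rule zero_sum_free_mono[OF z]) simp
    have z2: "zero_sum_free m {#b, c#}" by (rule zero_sum_free_mono[OF z]) simp
    have eq: "mset_set {h, b, c} = {#h, b, c#}" using dist by simp
    have "card (subsums m {#h, b, c#}) \<ge> 6"
      using card_subsums_3_ge_6[of m "{h, b, c}"] z3 eq \<open>m > 0\<close> dist set assms(4) by simp
    moreover have "card (subsums m {#b, c#}) \<ge> 4"
      by (rule card_subsums_pair[OF \<open>m > 0\<close> z2]) (use dist set assms(4) in auto)
    moreover have "card (subsums m ?N) + size M \<le> m + 1 + size ?N"
      by (rule card_subsums_proper_le[OF \<open>m > 0\<close> M N])
    moreover have "size ?N = 5" by simp
    \<comment> \<open>At least \<open>6 + 4 - 1 = 9\<close> subsums, against at most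
      \<open>m + 1 + 5 - (m - 2) = 8\<close>.\<close>
    ultimately show False
      using card_subsums_add[OF \<open>m > 0\<close> z] assms(7) by linarith
  qed
qed

lemma width_le_2:
  assumes M: "minimal_zero_sum m M" and set: "set_mset M \<subseteq> {1..<m}"
    and ext: "size M + card (set_mset M) = m + 1" and "m \<noteq> 6"
  shows "card (set_mset M) \<le> 2"
proof (rule ccontr)
  assume "\<not> ?thesis"
  hence ge3: "card (set_mset M) \<ge> 3" by simp
  have proper: "mset_set (set_mset M) \<subset># M"
    by (rule multiplicity_if_extremal) (use assms ge3 in auto)
  have "m > 0" using set ge3 by (cases m) auto
  have z: "zero_sum_free m (mset_set (set_mset M))"
    by (rule zero_sum_free_if_proper[OF M proper])
  have le: "card (subsums m (mset_set (set_mset M))) \<le> 2 * card (set_mset M)"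
    using card_subsums_proper_le[OF \<open>m > 0\<close> M proper] ext by simp
  show False
  proof (cases "card (set_mset M) = 3")
    case False
    thus False using card_subsums_set_ge_Suc[OF \<open>m > 0\<close> set _ z] le ge3 by simp
  next
    case True
    have sz: "size M + 2 = m" using ext True by simp
    from \<open>m > 0\<close> set True z show False
    proof (cases rule: card_3_cases)
      case 1
      thus False using le True by simp
    next
      case (2 a b c)
      have sub: "{a, b, c} \<subseteq> {1..<m}" using 2(1) set by simp
      have "\<not> card (subsums m (mset_set (set_mset M))) \<ge> 7" using le True by simp
      hence "\<not> card (subsums m {#a, b, c#}) \<ge> 7" using 2 by simp
      moreover have "zero_sum_free m {#a, b, c#}" using z 2 by simp
      \<comment> \<open>At most six subsums are allowed in width three, so a second relation must
        hold, and it makes \<open>a\<close> or \<open>b\<close> an involution.\<close>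
      ultimately have "[b = a + c] (mod m) \<or> [a = b + c] (mod m)"
        using card_subsums_triple_ge_7[OF \<open>m > 0\<close>, of a b c] 2 sub by auto
      hence "2 * a = m \<or> 2 * b = m"
        using cong_add_swap_imp_double[of c a b m] cong_add_swap_imp_double[of c b a m] 2 sub
          double_eq_modulus[of a m] double_eq_modulus[of b m] by (auto simp: add.commute)
      thus False
        using no_extremal_with_involution[OF M _ _ set _ _ sz \<open>m \<noteq> 6\<close> proper, of a b c]
          no_extremal_with_involution[OF M _ _ set _ _ sz \<open>m \<noteq> 6\<close> proper, of b a c] 2
        by (auto simp: insert_commute add.commute)
    qed
  qed
qed

section \<open>Extremal multisets of width one and two\<close>

text \<open>If \<open>g = gcd a m\<close> is at least 2, then \<open>m div g\<close> copies of
  \<open>a\<close> sum to a multiple of \<open>m\<close>, and this many are available.\<close>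

lemma coprime_if_zero_sum_free_replicate:
  assumes "zero_sum_free m (replicate_mset k a)" "m div 2 \<le> k" "m > 0"
  shows "coprime a m"
proof (rule ccontr)
  assume "\<not> coprime a m"
  define g where "g = gcd a m"
  have "g \<noteq> 1" using \<open>\<not> coprime a m\<close> unfolding g_def coprime_iff_gcd_eq_1 .
  moreover have "g \<noteq> 0" using assms(3) by (simp add: g_def)
  ultimately have "2 \<le> g" by linarith
  hence "m div g \<le> m div 2" by (intro div_le_mono2) auto
  hence "replicate_mset (m div g) a \<subseteq># replicate_mset k a"
    using assms(2) by (simp add: replicate_mset_msubseteq_iff)
  moreover have "m dvd sum_mset (replicate_mset (m div g) a)"
  proof -
    have "m div g * a = m * (a div g)"
      using dvd_div_mult[of g m a] div_mult_swap[of g a m] by (simp only: g_def gcd_dvd1 gcd_dvd2)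
    thus ?thesis by simp
  qed
  ultimately have "replicate_mset (m div g) a = {#}"
    using assms(1) unfolding zero_sum_free_def by blast
  hence "m div g = 0" by simp
  moreover have "g \<le> m" using assms(3) by (simp add: g_def)
  ultimately show False using \<open>2 \<le> g\<close> by (simp add: div_eq_0_iff)
qed

lemma extremal_width_1:
  assumes M: "minimal_zero_sum m M" and "set_mset M = {a}" "size M = m" "m \<ge> 2"
  shows "M = replicate_mset m a \<and> coprime a m"
proof
  show eq: "M = replicate_mset m a"
    using set_mset_subset_singletonD[of M a] assms(2,3) by simp
  have "zero_sum_free m (replicate_mset (m - 1) a)"
    by (rule zero_sum_free_if_proper[OF M])
       (use assms(4) in \<open>simp add: eq subset_mset.less_le replicate_mset_msubseteq_iff replicate_mset_eq_iff\<close>)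
  thus "coprime a m" by (rule coprime_if_zero_sum_free_replicate) (use assms(4) in auto)
qed

text \<open>The \<open>m - 2\<close> copies of \<open>a\<close> are zero-sum free, whence
  coprimality; adding \<open>2 * a\<close> to the vanishing total identifies \<open>b\<close> with
  \<open>2 * a\<close> modulo \<open>m\<close>.\<close>

lemma extremal_width_2_aux:
  assumes M: "minimal_zero_sum m M" and eq: "M = add_mset b (replicate_mset (m - 2) a)"
    and "b < m" "m \<ge> 3"
  shows "coprime a m \<and> M = add_mset (2 * a mod m) (replicate_mset (m - 2) a)"
proof
  have "zero_sum_free m (replicate_mset (m - 2) a)"
    by (rule zero_sum_free_if_proper[OF M]) (simp add: eq subset_mset.less_le)
  thus "coprime a m" by (rule coprime_if_zero_sum_free_replicate) (use assms(4) in auto)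
  have "m dvd b + (m - 2) * a" using M eq by (simp add: minimal_zero_sum_def)
  hence "[b + (m - 2) * a + 2 * a = 0 + 2 * a] (mod m)"
    by (intro cong_add) (auto simp: cong_0_iff)
  moreover have "b + (m - 2) * a + 2 * a = b + m * a"
  proof -
    have "b + (m - 2) * a + 2 * a = b + (m - 2 + 2) * a" by (simp only: add_mult_distrib add.assoc)
    moreover have "m - 2 + 2 = m" using assms(4) by simp
    ultimately show ?thesis by (simp only:)
  qed
  ultimately have "b mod m = 2 * a mod m" by (simp add: cong_def)
  thus "M = add_mset (2 * a mod m) (replicate_mset (m - 2) a)" using eq assms(3) by simp
qed

lemma extremal_width_2:
  assumes M: "minimal_zero_sum m M" and set: "set_mset M = {a, b}" "a \<noteq> b" "{a, b} \<subseteq> {1..<m}"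
    and sz: "size M + 1 = m" and "m \<ge> 4"
  shows "\<exists>c\<in>{a, b}. coprime c m \<and> M = add_mset (2 * c mod m) (replicate_mset (m - 2) c)"
proof -
  have "m > 0" using sz by simp
  define p q where "p = count M a" and "q = count M b"
  have pq: "p > 0" "q > 0" using set by (simp_all add: p_def q_def count_greater_zero_iff)
  have Meq: "M = replicate_mset p a + replicate_mset q b"
  proof (rule multiset_eqI)
    fix x show "count M x = count (replicate_mset p a + replicate_mset q b) x"
      using set not_in_iff[of x M] by (auto simp: p_def q_def)
  qed
  have pqm: "p + q + 1 = m" using sz Meq by simp
  consider "p = 1" | "q = 1" | "p \<ge> 2" "q \<ge> 2" using pq by linarith
  thus ?thesis
  proof cases
    case 1
    hence "q = m - 2" using pqm by simp
    hence "M = add_mset a (replicate_mset (m - 2) b)" using Meq 1 by simp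
    from extremal_width_2_aux[OF M this] show ?thesis using set assms(6) by auto
  next
    case 2
    hence "p = m - 2" using pqm by simp
    hence "M = add_mset b (replicate_mset (m - 2) a)" using Meq 2 by simp
    from extremal_width_2_aux[OF M this] show ?thesis using set assms(6) by auto
  next
    case 3
    let ?N = "{#a, b#} + {#a, b#}"
    have sub: "?N \<subseteq># M" using 3 set by (auto simp: subseteq_mset_def p_def q_def)
    have proper: "{#a, b#} \<subset># M"
    proof -
      have "{#a, b#} \<subset># ?N" by (simp add: subset_mset.less_le)
      thus ?thesis using sub by (rule subset_mset.less_le_trans)
    qed
    show ?thesis
    proof (cases "?N = M")
      case True
      from this[symmetric] sz have "m = 5" by simp
      moreover have "m dvd sum_mset M" using M by (simp add: minimal_zero_sum_def)
      \<comment> \<open>The total is \<open>2 * (a + b)\<close>; as 5 is odd,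
        \<open>{#a, b#}\<close> is already zero-sum.\<close>
      ultimately have "5 dvd a + (b + (a + b))" using True[symmetric] by simp
      hence "5 dvd a + b" by presburger
      hence "{#a, b#} = M"
        using minimal_zero_sum_eq[OF M, of "{#a, b#}"] proper \<open>m = 5\<close> by (simp add: subset_mset.less_le)
      with proper show ?thesis by simp
    next
      case False
      hence N: "?N \<subset># M" using sub by (simp add: subset_mset.less_le)
      have z: "zero_sum_free m ?N" by (rule zero_sum_free_if_proper[OF M N])
      have z2: "zero_sum_free m {#a, b#}" by (rule zero_sum_free_mono[OF z]) simp
      have "card (subsums m {#a, b#}) \<ge> 4"
        by (rule card_subsums_pair[OF \<open>m > 0\<close> z2]) (use set in auto)
      moreover have "card (subsums m ?N) + size M \<le> m + 1 + size ?N"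
        by (rule card_subsums_proper_le[OF \<open>m > 0\<close> M N])
      moreover have "size ?N = 4" by simp
      \<comment> \<open>At least \<open>4 + 4 - 1 = 7\<close> subsums, against at most
        \<open>m + 1 + 4 - (m - 1) = 6\<close>.\<close>
      ultimately have False
        using card_subsums_add[OF \<open>m > 0\<close> z] sz by linarith
      thus ?thesis ..
    qed
  qed
qed

section \<open>Listing and counting the extremal multisets\<close>

definition extremal_multisets :: "nat \<Rightarrow> nat multiset set" where
  "extremal_multisets m = {M. minimal_zero_sum m M \<and> set_mset M \<subseteq> {1..<m} \<and>
     size M + card (set_mset M) = m + 1}"

lemma coprime_dvd_imp_multiple:
  assumes "coprime a m" "m dvd k * a" "k \<le> (m::nat)"
  shows "k = 0 \<or> k = m"
proof -
  have "coprime m a" using assms(1) by (simp add: coprime_commute)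
  hence "m dvd k" using assms(2) by (simp only: coprime_dvd_mult_left_iff)
  thus ?thesis using assms(3) by (cases "k = 0") (auto dest: dvd_imp_le)
qed

lemma replicate_mset_extremal:
  assumes "a \<in> totatives m" "m \<ge> 3"
  shows "replicate_mset m a \<in> extremal_multisets m"
proof -
  have cop: "coprime a m" and a: "a > 0" "a \<le> m" using assms by (auto simp: in_totatives_iff)
  have "a \<noteq> m" using cop assms(2) by auto
  have "minimal_zero_sum m (replicate_mset m a)"
    unfolding minimal_zero_sum_def
  proof (intro conjI allI impI)
    fix N assume N: "N \<subseteq># replicate_mset m a" "N \<noteq> {#}" "m dvd sum_mset N"
    then obtain k where k: "k \<le> m" "N = replicate_mset k a" by (auto elim: msubseteq_replicate_msetE)
    thus "N = replicate_mset m a" using coprime_dvd_imp_multiple[OF cop, of k] N by auto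
  qed (use assms in auto)
  thus ?thesis using a \<open>a \<noteq> m\<close> assms(2) by (simp add: extremal_multisets_def)
qed

text \<open>Ensures that the second family consists of nonzero residues and has width exactly
  two.\<close>

lemma double_mod_totative:
  assumes "a \<in> totatives m" "m \<ge> 3"
  shows "2 * a mod m \<noteq> 0" "2 * a mod m \<noteq> a"
proof -
  have cop: "coprime a m" and a: "a > 0" "a \<le> m" using assms by (auto simp: in_totatives_iff)
  have "a < m" using cop assms(2) a by (cases "a = m") auto
  have "\<not> m dvd 2 * a"
    using coprime_dvd_imp_multiple[OF cop, of 2] assms(2) by auto
  thus "2 * a mod m \<noteq> 0" by (simp add: dvd_eq_mod_eq_0)
  show "2 * a mod m \<noteq> a"
  proof
    assume "2 * a mod m = a"
    hence "[a + a = 0 + a] (mod m)" using \<open>a < m\<close> by (simp add: cong_def mult_2)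
    hence "m dvd a" by (simp only: cong_add_rcancel_nat cong_0_iff)
    thus False using a \<open>a < m\<close> by (auto dest: dvd_imp_le)
  qed
qed

text \<open>The element \<open>2 * a mod m\<close> acts like two copies of \<open>a\<close>. A
  subsum using it and \<open>k\<close> copies of \<open>a\<close> is \<open>(k + 2) * a\<close>,
  which vanishes only for \<open>k = m - 2\<close>; a subsum of \<open>k\<close> copies alone
  vanishes only for \<open>k = 0\<close>.\<close>

lemma add_double_replicate_extremal:
  assumes "a \<in> totatives m" "m \<ge> 3"
  shows "add_mset (2 * a mod m) (replicate_mset (m - 2) a) \<in> extremal_multisets m" (is "?M \<in> _")
proof -
  have cop: "coprime a m" and a: "a > 0" "a \<le> m" using assms by (auto simp: in_totatives_iff)
  have "a < m" using cop assms(2) a by (cases "a = m") auto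
  note dbl = double_mod_totative[OF assms]
  have dvd_iff: "m dvd 2 * a mod m + k * a \<longleftrightarrow> m dvd (k + 2) * a" for k
  proof -
    have "[2 * a mod m + k * a = 2 * a + k * a] (mod m)" by (intro cong_add) auto
    hence "m dvd 2 * a mod m + k * a \<longleftrightarrow> m dvd 2 * a + k * a" by (rule cong_dvd_iff)
    thus ?thesis by (simp only: add_mult_distrib add.commute)
  qed
  have "minimal_zero_sum m ?M"
    unfolding minimal_zero_sum_def
  proof (intro conjI allI impI)
    have "m - 2 + 2 = m" using assms(2) by simp
    hence "m dvd (m - 2 + 2) * a" by (simp only: dvd_triv_left)
    thus "m dvd sum_mset ?M" unfolding dvd_iff[symmetric] by simp
    fix N assume N: "N \<subseteq># ?M" "N \<noteq> {#}" "m dvd sum_mset N"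
    show "N = ?M"
    proof (cases "2 * a mod m \<in># N")
      case False
      hence "N \<subseteq># replicate_mset (m - 2) a"
        using N(1) by (metis subset_eq_diff_conv diff_single_trivial add_mset_add_single)
      then obtain k where k: "k \<le> m - 2" "N = replicate_mset k a" by (auto elim: msubseteq_replicate_msetE)
      hence "k < m" using assms(2) by linarith
      moreover have "m dvd k * a" using N(3) k by simp
      ultimately have "k = 0" using coprime_dvd_imp_multiple[OF cop, of k] by linarith
      thus ?thesis using k N(2) by simp
    next
      case True
      then obtain K where K: "N = add_mset (2 * a mod m) K" by (metis mset_add)
      hence "K \<subseteq># replicate_mset (m - 2) a" using N(1) by simp
      then obtain k where k: "k \<le> m - 2" "K = replicate_mset k a" by (auto elim: msubseteq_replicate_msetE)
      hence "m dvd (k + 2) * a" using N(3) K by (simp only: dvd_iff[symmetric]) simp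
      moreover have "k + 2 \<le> m" using k(1) assms(2) by linarith
      ultimately have "k = m - 2" using coprime_dvd_imp_multiple[OF cop, of "k + 2"] by linarith
      thus ?thesis using k K by simp
    qed
  qed auto
  moreover have "set_mset ?M = {2 * a mod m, a}" using assms(2) by simp
  ultimately show ?thesis using dbl a \<open>a < m\<close> assms(2) by (simp add: extremal_multisets_def)
qed

lemma extremal_multisets_eq:
  assumes "m \<ge> 4" "m \<noteq> 6"
  shows "extremal_multisets m = (\<lambda>a. replicate_mset m a) ` totatives m \<union>
    (\<lambda>a. add_mset (2 * a mod m) (replicate_mset (m - 2) a)) ` totatives m" (is "_ = ?A \<union> ?B")
proof (intro equalityI subsetI)
  fix M assume "M \<in> extremal_multisets m"
  hence M: "minimal_zero_sum m M" "set_mset M \<subseteq> {1..<m}" "size M + card (set_mset M) = m + 1"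
    by (auto simp: extremal_multisets_def)
  have "card (set_mset M) \<noteq> 0" using M(1) by (simp add: minimal_zero_sum_def)
  moreover have "card (set_mset M) \<le> 2" by (rule width_le_2[OF M \<open>m \<noteq> 6\<close>])
  ultimately consider "card (set_mset M) = 1" | "card (set_mset M) = 2" by linarith
  thus "M \<in> ?A \<union> ?B"
  proof cases
    case 1
    then obtain a where a: "set_mset M = {a}" by (auto simp: card_1_singleton_iff)
    have "M = replicate_mset m a \<and> coprime a m"
      by (rule extremal_width_1[OF M(1) a]) (use M(3) 1 assms(1) in auto)
    moreover have "a > 0" "a \<le> m" using M(2) a by auto
    ultimately have "M \<in> ?A" by (auto simp: in_totatives_iff)
    thus ?thesis ..
  next
    case 2
    then obtain a b where ab: "set_mset M = {a, b}" "a \<noteq> b" by (auto simp: card_2_iff)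
    then obtain c where c: "c \<in> {a, b}" "coprime c m"
      "M = add_mset (2 * c mod m) (replicate_mset (m - 2) c)"
      using extremal_width_2[OF M(1) ab] M(2,3) 2 assms(1) by auto
    moreover have "c > 0" "c \<le> m" using M(2) ab c(1) by auto
    ultimately have "M \<in> ?B" by (auto simp: in_totatives_iff)
    thus ?thesis ..
  qed
next
  fix M assume "M \<in> ?A \<union> ?B"
  thus "M \<in> extremal_multisets m"
    using assms(1) replicate_mset_extremal add_double_replicate_extremal by auto
qed

lemma card_extremal_multisets:
  assumes "m \<ge> 4" "m \<noteq> 6"
  shows "card (extremal_multisets m) = 2 * totient m"
proof -
  let ?f = "\<lambda>a. replicate_mset m a"
  let ?g = "\<lambda>a. add_mset (2 * a mod m) (replicate_mset (m - 2) a)"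
  have "inj_on ?f (totatives m)" using assms(1) by (auto simp: inj_on_def replicate_mset_eq_iff)
  hence f: "card (?f ` totatives m) = totient m" by (simp add: card_image totient_def)
  have "inj_on ?g (totatives m)"
  \<comment> \<open>For \<open>m\<close> at least 4, \<open>a\<close> is the only element that
    occurs twice or more. For \<open>m = 3\<close>, the generators 1 and 2 would yield the same
    multiset.\<close>
  proof (rule inj_onI, rule ccontr)
    fix a b assume ab: "?g a = ?g b" "a \<noteq> b"
    have "count (?g a) a \<ge> m - 2" by simp
    hence "count (?g a) a \<ge> 2" using assms(1) by linarith
    moreover have "count (?g b) a \<le> 1" using ab(2) by simp
    ultimately show False using ab(1) by simp
  qed
  hence g: "card (?g ` totatives m) = totient m" by (simp add: card_image totient_def)
  \<comment> \<open>The families differ in size: \<open>m\<close> against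
    \<open>m - 1\<close>.\<close>
  have "?f ` totatives m \<inter> ?g ` totatives m = {}"
  proof (rule ccontr)
    assume "?f ` totatives m \<inter> ?g ` totatives m \<noteq> {}"
    then obtain a b where "?f a = ?g b" by blast
    hence "size (?f a) = size (?g b)" by simp
    thus False using assms(1) by simp
  qed
  thus ?thesis
    unfolding extremal_multisets_eq[OF assms] by (subst card_Un_disjoint) (auto simp: f g)
qed

subsection \<open>Solutions as multisets\<close>

lemma sum_mset_eq_sum:
  fixes M :: "nat multiset"
  assumes "set_mset M \<subseteq> A" "finite A"
  shows "sum_mset M = (\<Sum>i\<in>A. i * count M i)"
  using assms(1)
proof (induction M)
  case empty
  show ?case by simp
next
  case (add a M)
  have "(\<Sum>i\<in>A. i * count (add_mset a M) i) = (\<Sum>i\<in>A. i * count M i + (if a = i then i else 0))"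
    by (intro sum.cong) auto
  also have "\<dots> = sum_mset M + a" using add assms(2) by (simp add: sum.distrib)
  finally show ?case by simp
qed

lemma size_eq_sum:
  assumes "set_mset M \<subseteq> A" "finite A"
  shows "size M = (\<Sum>i\<in>A. count M i)"
  unfolding size_multiset_overloaded_eq
  by (rule sum.mono_neutral_left) (use assms in \<open>auto simp: not_in_iff\<close>)

lemma count_in_vectors: "count M \<in> vectors m \<longleftrightarrow> set_mset M \<subseteq> {1..<m}"
  unfolding vectors_def mem_Collect_eq subset_iff count_eq_zero_iff by blast

lemma count_in_nonzero_solutions:
  "count M \<in> nonzero_solutions m \<longleftrightarrow> set_mset M \<subseteq> {1..<m} \<and> M \<noteq> {#} \<and> m dvd sum_mset M"
proof (cases "set_mset M \<subseteq> {1..<m}")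
  case True
  have "count M = (\<lambda>_. 0) \<longleftrightarrow> M = {#}" by (auto simp: multiset_eq_iff fun_eq_iff)
  thus ?thesis
    using True sum_mset_eq_sum[OF True]
    by (auto simp: nonzero_solutions_def solutions_def count_in_vectors cong_0_iff)
qed (simp add: nonzero_solutions_def solutions_def count_in_vectors)

text \<open>Finite support makes every vector the count function of a multiset, so results about
  multisets transfer to all solutions.\<close>

lemma vectors_eq_count:
  assumes "x \<in> vectors m"
  obtains M where "x = count M"
proof -
  have "{i. 0 < x i} \<subseteq> {1..<m}" using assms by (fastforce simp: vectors_def)
  hence "finite {i. 0 < x i}" by (rule finite_subset) simp
  hence "x = count (Abs_multiset x)" by simp
  thus ?thesis by (rule that)
qed

lemma count_le_iff: "count N \<le> count M \<longleftrightarrow> N \<subseteq># M"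
  by (simp add: le_fun_def subseteq_mset_def)

lemma indecomposable_count:
  "indecomposable m (count M) \<longleftrightarrow> set_mset M \<subseteq> {1..<m} \<and> minimal_zero_sum m M"
proof
  assume *: "indecomposable m (count M)"
  hence M: "set_mset M \<subseteq> {1..<m}" "M \<noteq> {#}" "m dvd sum_mset M"
    by (auto simp: indecomposable_def count_in_nonzero_solutions)
  have "N = M" if "N \<subseteq># M" "N \<noteq> {#}" "m dvd sum_mset N" for N
  proof -
    have "set_mset N \<subseteq> {1..<m}" using M(1) set_mset_mono[OF that(1)] by blast
    hence "count N = count M"
      using * that by (auto simp: indecomposable_def count_in_nonzero_solutions count_le_iff)
    thus ?thesis by (simp add: count_inject)
  qed
  thus "set_mset M \<subseteq> {1..<m} \<and> minimal_zero_sum m M"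
    using M by (auto simp: minimal_zero_sum_def)
next
  assume *: "set_mset M \<subseteq> {1..<m} \<and> minimal_zero_sum m M"
  show "indecomposable m (count M)"
    unfolding indecomposable_def
  proof (intro conjI ballI impI)
    show "count M \<in> nonzero_solutions m"
      using * by (auto simp: count_in_nonzero_solutions minimal_zero_sum_def)
    fix y assume y: "y \<in> nonzero_solutions m" "y \<le> count M"
    hence "y \<in> vectors m" by (auto simp: nonzero_solutions_def solutions_def)
    then obtain N where "y = count N" by (rule vectors_eq_count)
    thus "y = count M"
      using y * minimal_zero_sum_eq[of m M N]
      by (auto simp: count_in_nonzero_solutions count_le_iff)
  qed
qed

lemma extremal_count: "extremal m (count M) \<longleftrightarrow> M \<in> extremal_multisets m"
proof (cases "set_mset M \<subseteq> {1..<m}")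
  case True
  have "supp m (count M) = set_mset M" using True by (auto simp: supp_def)
  moreover have "vlength m (count M) = size M" using size_eq_sum[OF True] by (simp add: vlength_def)
  ultimately show ?thesis
    using True by (simp add: extremal_def indecomposable_count width_def extremal_multisets_def)
qed (simp add: extremal_def indecomposable_count extremal_multisets_def)

lemma extremal_eq_image: "{x. extremal m x} = count ` extremal_multisets m"
proof (intro equalityI subsetI)
  fix x assume "x \<in> {x. extremal m x}"
  hence x: "extremal m x" by simp
  hence "x \<in> vectors m"
    by (auto simp: extremal_def indecomposable_def nonzero_solutions_def solutions_def)
  then obtain M where "x = count M" by (rule vectors_eq_count)
  thus "x \<in> count ` extremal_multisets m" using x extremal_count by auto
qed (auto simp: extremal_count)

(* The count is not claimed for m = 3: there the extremal solutions are exactly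
   (3,0), (0,3) and (1,1), three of them, whereas 2 * totient 3 = 4. *)
theorem theorem1:
  fixes m :: nat
  assumes "m \<ge> 3" and "m \<noteq> 6"
  shows "(\<forall>x. extremal m x \<longrightarrow> width m x = 1 \<or> width m x = 2) \<and>
         (m \<noteq> 3 \<longrightarrow> card {x. extremal m x} = 2 * totient m)"
proof (intro conjI allI impI)
  fix x assume "extremal m x"
  then obtain M where M: "x = count M" "M \<in> extremal_multisets m"
    using extremal_eq_image by blast
  hence *: "minimal_zero_sum m M" "set_mset M \<subseteq> {1..<m}" "size M + card (set_mset M) = m + 1"
    by (auto simp: extremal_multisets_def)
  have "supp m x = set_mset M" using *(2) M(1) by (auto simp: supp_def)
  hence "width m x = card (set_mset M)" by (simp add: width_def)
  moreover have "card (set_mset M) \<noteq> 0" using *(1) by (simp add: minimal_zero_sum_def)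
  moreover have "card (set_mset M) \<le> 2" by (rule width_le_2[OF * assms(2)])
  ultimately show "width m x = 1 \<or> width m x = 2" by linarith
next
  assume "m \<noteq> 3"
  have "card (count ` extremal_multisets m) = card (extremal_multisets m)"
    by (rule card_image) (auto simp: inj_on_def count_inject)
  thus "card {x. extremal m x} = 2 * totient m"
    using card_extremal_multisets[of m] assms \<open>m \<noteq> 3\<close> by (simp add: extremal_eq_image)
qed

end
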